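(* Let $\lambda\in\{2,3\}$ and let $n,m_0\in\mathbb{N}$ be such that there exists a $\lambda$-edge-connected path-complete graph of order $n$ and size at least $m_0$; let $PK^{\lambda}_{n,m_0}$ be such a graph of minimum size. Let $D$ be a $\lambda$-edge-connected Eulerian digraph of order $n$ and size at least $2m_0$. Then $$\rho(D)\le\rho(\overleftrightarrow{PK^{\lambda}_{n,m_0}}).$$ This bound is sharp, i.e. it is attained by some $\lambda$-edge-connected Eulerian digraph of order $n$ and size at least $2m_0$.
   Context: Graphs and digraphs are finite, without loops or multiple edges/arcs (opposite arcs are allowed). $\mathbb{N}$ denotes the positive integers. Order is the number of vertices; size is the number of edges of a graph, respectively arcs of a digraph. A digraph is strong if there is a directed path between every ordered pair of vertices. An Eulerian digraph is a strong digraph that contains an Eulerian circuit (a closed directed trail using every arc). The edge-connectivity of a digraph is the minimum number of arcs that must be removed to make it not strong; a digraph is $\lambda$-edge-connected if its edge-connectivity is at least $\lambda$. For a strong digraph $D$ of order $n\ge2$, the remoteness is $\rho(D)=\max_{v\in V(D)}\frac{1}{n-1}\sum_{w\in V(D)}d_D(v,w)$, where $d_D(v,w)$ is the length of a shortest directed path from $v$ to $w$. For a graph $G$, $\overleftrightarrow{G}$ is the digraph obtained by replacing each edge by two arcs in opposite directions. For disjoint graphs $G_1,\ldots,G_k$, the sequential sum $G_1+\cdots+G_k$ is obtained from their union by joining every vertex of $G_i$ to every vertex of $G_{i+1}$, $i=1,\ldots,k-1$. The notation $[K_1+K_\lambda]^k$ stands for $k$ consecutive repetitions of the pattern $K_1+K_\lambda$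 in a sequential sum. For $\lambda\in\{2,3\}$, a $\lambda$-edge-connected path-complete graph is a graph $G$ for which there exist $k\in\mathbb{N}\cup\{0\}$ and $a,b\in\mathbb{N}$ such that one of the following holds: (i) $G=[K_1+K_\lambda]^k+K_a+K_b$ with $k\ge1$ and $ab\ge\lambda$; (ii) $G=[K_1+K_\lambda]^k+K_1+K_a+K_b$ with $a\ge\lambda$; (iii) $\lambda=3$ and $G=[K_1+K_3]^k+K_2+K_a+K_1$ with $k\ge1$ and $a\ge3$. *)

theory Defs
  imports Complex_Main "Graph_Theory.Graph_Theory"
begin

section \<open>Digraphs\<close>

text \<open>
  Finite digraphs without loops and multiple arcs are those satisfying the locale predicate
  \<^const>\<open>digraph\<close>; order and size are \<^term>\<open>card (verts D)\<close> and \<^term>\<open>card (arcs D)\<close>.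
\<close>

definition eulerian_digraph :: "('a, 'b) pre_digraph \<Rightarrow> bool" where
  "eulerian_digraph D \<longleftrightarrow>
     digraph D \<and> strongly_connected D \<and> (\<exists>u p. pre_digraph.euler_trail D u p u)"

definition del_arcs :: "('a, 'b) pre_digraph \<Rightarrow> 'b set \<Rightarrow> ('a, 'b) pre_digraph" where
  "del_arcs D A = D\<lparr>arcs := arcs D - A\<rparr>"

text \<open>
  For finite digraphs of order at least 2 the set below is finite and nonempty, since
  deleting all arcs leaves a digraph that is not strong.
\<close>

definition edge_connectivity :: "('a, 'b) pre_digraph \<Rightarrow> nat" where
  "edge_connectivity D =
     Min {card A | A. A \<subseteq> arcs D \<and> \<not> strongly_connected (del_arcs D A)}"

definition edge_connected :: "nat \<Rightarrow> ('a, 'b) pre_digraph \<Rightarrow> bool" where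
  "edge_connected lam D \<longleftrightarrow> lam \<le> edge_connectivity D"

text \<open>Meaningful only if \<open>w\<close> is reachable from \<open>v\<close>, as is always the case in a strong digraph.\<close>

definition di_dist :: "('a, 'b) pre_digraph \<Rightarrow> 'a \<Rightarrow> 'a \<Rightarrow> nat" where
  "di_dist D v w = (LEAST k. \<exists>p. pre_digraph.apath D v p w \<and> length p = k)"

definition remoteness :: "('a, 'b) pre_digraph \<Rightarrow> real" where
  "remoteness D =
     Max ((\<lambda>v. (\<Sum>w\<in>verts D. real (di_dist D v w)) / (real (card (verts D)) - 1)) ` verts D)"

section \<open>Undirected graphs and sequential sums\<close>

text \<open>
  The library models undirected graphs as symmetric digraphs. Here edges are kept as
  two-element sets, so that the size of a graph (number of edges) and the bidirected digraph
  obtained from it remain separate notions.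
\<close>

record 'a ugraph =
  uverts :: "'a set"
  uedges :: "'a set set"

definition bidirected :: "'a ugraph \<Rightarrow> ('a, 'a \<times> 'a) pre_digraph" where
  "bidirected G = with_proj \<lparr>pverts = uverts G, parcs = {(x, y). {x, y} \<in> uedges G}\<rparr>"

definition is_complete :: "nat \<Rightarrow> 'a ugraph \<Rightarrow> bool" where
  "is_complete n G \<longleftrightarrow> finite (uverts G) \<and> card (uverts G) = n \<and>
     uedges G = {{x, y} | x y. x \<in> uverts G \<and> y \<in> uverts G \<and> x \<noteq> y}"

definition sequential_sum :: "'a ugraph list \<Rightarrow> 'a ugraph" where
  "sequential_sum Gs =
     \<lparr>uverts = (\<Union>G\<in>set Gs. uverts G),
      uedges = (\<Union>G\<in>set Gs. uedges G) \<union>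
        {{x, y} | x y i. Suc i < length Gs \<and> x \<in> uverts (Gs ! i) \<and> y \<in> uverts (Gs ! Suc i)}\<rparr>"

text \<open>
  \<open>is_K_sum [n\<^sub>1, \<dots>, n\<^sub>k] G\<close> says that \<open>G\<close> is a sequential sum of disjoint complete graphs of
  orders \<open>n\<^sub>1, \<dots>, n\<^sub>k\<close>. Leaving the vertex sets arbitrary makes this the usual
  ``up to isomorphism'' reading of such a sum.
\<close>

definition is_K_sum :: "nat list \<Rightarrow> 'a ugraph \<Rightarrow> bool" where
  "is_K_sum ns G \<longleftrightarrow>
     (\<exists>Gs. list_all2 is_complete ns Gs \<and>
           (\<forall>j<length Gs. \<forall>i<j. uverts (Gs ! i) \<inter> uverts (Gs ! j) = {}) \<and>
           G = sequential_sum Gs)"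

abbreviation repeat :: "nat \<Rightarrow> 'a list \<Rightarrow> 'a list" where
  "repeat k xs \<equiv> concat (replicate k xs)"

definition path_complete :: "nat \<Rightarrow> 'a ugraph \<Rightarrow> bool" where
  "path_complete lam G \<longleftrightarrow>
     (\<exists>k a b. 1 \<le> a \<and> 1 \<le> b \<and>
        (is_K_sum (repeat k [1, lam] @ [a, b]) G \<and> 1 \<le> k \<and> lam \<le> a * b \<or>
         is_K_sum (repeat k [1, lam] @ [1, a, b]) G \<and> lam \<le> a \<or>
         lam = 3 \<and> is_K_sum (repeat k [1, 3] @ [2, a, 1]) G \<and> 1 \<le> k \<and> 3 \<le> a))"

text \<open>
  Minimality is tested against graphs over the vertex type of \<open>G\<close>. This is no restriction:
  as \<open>G\<close> has \<open>n\<close> vertices, every graph of order \<open>n\<close> has an isomorphic copy over that type.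
\<close>

definition min_path_complete :: "nat \<Rightarrow> nat \<Rightarrow> nat \<Rightarrow> 'a ugraph \<Rightarrow> bool" where
  "min_path_complete lam n m0 G \<longleftrightarrow>
     path_complete lam G \<and> card (uverts G) = n \<and> m0 \<le> card (uedges G) \<and>
     (\<forall>H :: 'a ugraph. path_complete lam H \<and> card (uverts H) = n \<and> m0 \<le> card (uedges H)
        \<longrightarrow> card (uedges G) \<le> card (uedges H))"

end

(*
  Let v be a vertex of D and let n_0 = 1, n_1, ..., n_d be the numbers of vertices at distance
  0, 1, ..., d from v. Then n_i n_(i+1) >= lam since the arcs between two consecutive layers
  form a cut. As D is balanced, the differences d(v, head) - d(v, tail) sum to 0 over all arcs,
  so there are at most as many backward as forward arcs and D has at most as many arcs as the
  bidirected sequential sum of complete graphs of orders n_0, ..., n_d. Exchange moves between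
  layers turn this sequence into that of a path-complete graph of the same order without
  decreasing the total distance or the size. Among path-complete graphs of equal order, larger
  total distance goes with smaller size, so the one of minimum size has the largest remoteness.
*)
theory Submission
  imports Defs
begin

section \<open>Sequences of layer sizes\<close>

text \<open>The restriction to \<open>lam\<close> = 2 or 3 enters through one fact: for positive x
  and y, the condition \<open>lam\<close> <= x * y is then the same as \<open>lam\<close> + 1 <= x +
  y. For 4 this fails, as 2 * 2 shows. In the sum form the condition survives moving a vertex
  between two consecutive layers as long as neither becomes empty. It also says that two consecutive
  layers form a clique on more than \<open>lam\<close> vertices, which gives the edge-connectivity
  of the extremal graph. Backward arcs may skip layers, so they cannot be counted by pairs of
  adjacent layers; forward arcs advance by exactly one layer and can. For \<open>lam\<close> = 3 an
  exchange move may lose one edge. In one situation \<open>pull_last\<close> repays it; in the other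
  the list is kept as it stands, and this is the third family of path-complete graphs.\<close>

text \<open>
  A list gives the sizes of the distance layers. Then \<open>dist_sum\<close> is the sum of all distances from
  layer 0, and \<open>close_pairs\<close> counts the ordered pairs of equal or adjacent vertices in the
  sequential sum, that is, twice the size plus the order.
\<close>

fun admissible :: "nat \<Rightarrow> nat list \<Rightarrow> bool" where
  "admissible lam (x # y # r) \<longleftrightarrow> lam \<le> x * y \<and> admissible lam (y # r)"
| "admissible lam _ \<longleftrightarrow> True"

fun dist_sum :: "nat list \<Rightarrow> nat" where
  "dist_sum [] = 0"
| "dist_sum (x # r) = sum_list r + dist_sum r"

fun close_pairs :: "nat list \<Rightarrow> nat" where
  "close_pairs (x # y # r) = x * x + 2 * x * y + close_pairs (y # r)"
| "close_pairs [x] = x * x"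
| "close_pairs [] = 0"

text \<open>The base cases are the three families at the smallest \<open>k\<close> they allow,
  namely 1, 0 and 1; \<open>rep\<close> prepends one more pattern. This turns the parameter
  \<open>k\<close> into an induction.\<close>

inductive pk_list :: "nat \<Rightarrow> nat list \<Rightarrow> bool" for lam where
  pair: "1 \<le> a \<Longrightarrow> 1 \<le> b \<Longrightarrow> lam \<le> a * b \<Longrightarrow> pk_list lam [1, lam, a, b]"
| triple: "lam \<le> a \<Longrightarrow> 1 \<le> b \<Longrightarrow> pk_list lam [1, a, b]"
| special: "lam = 3 \<Longrightarrow> 3 \<le> a \<Longrightarrow> pk_list lam [1, lam, 2, a, 1]"
| rep: "pk_list lam ns \<Longrightarrow> pk_list lam (1 # lam # ns)"

definition dominated :: "nat list \<Rightarrow> nat list \<Rightarrow> bool" where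
  "dominated s t \<longleftrightarrow> sum_list s = sum_list t \<and> dist_sum s \<le> dist_sum t \<and> close_pairs s \<le> close_pairs t"

lemma dominated_trans: "dominated s t \<Longrightarrow> dominated t u \<Longrightarrow> dominated s u"
  by (auto simp: dominated_def)

lemma path_complete_iff:
  assumes "1 \<le> lam"
  shows "path_complete lam G \<longleftrightarrow> (\<exists>ns. pk_list lam ns \<and> is_K_sum ns G)"
proof
  have pk1: "pk_list lam (repeat k [1, lam] @ [a, b])" if "1 \<le> a" "1 \<le> b" "1 \<le> k" "lam \<le> a * b" for k a b
    using that(3) by (induction k rule: dec_induct) (use that in \<open>auto intro: pk_list.intros[simplified]\<close>)
  have pk2: "pk_list lam (repeat k [1, lam] @ [1, a, b])" if "1 \<le> b" "lam \<le> a" for k a b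
    by (induction k) (use that in \<open>auto intro: pk_list.intros[simplified]\<close>)
  have pk3: "pk_list lam (repeat k [1, lam] @ [2, a, 1])" if "lam = 3" "1 \<le> k" "3 \<le> a" for k a
    using that(2) by (induction k rule: dec_induct) (use that in \<open>auto intro: pk_list.intros[simplified]\<close>)
  assume "path_complete lam G"
  then show "\<exists>ns. pk_list lam ns \<and> is_K_sum ns G"
    unfolding path_complete_def using pk1 pk2 pk3 by metis
next
  assume "\<exists>ns. pk_list lam ns \<and> is_K_sum ns G"
  then obtain ns where ns: "pk_list lam ns" "is_K_sum ns G" by blast
  from ns(1) have "\<exists>k a b. 1 \<le> a \<and> 1 \<le> b \<and>
        (ns = repeat k [1, lam] @ [a, b] \<and> 1 \<le> k \<and> lam \<le> a * b \<or>
         ns = repeat k [1, lam] @ [1, a, b] \<and> lam \<le> a \<or>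
         lam = 3 \<and> ns = repeat k [1, 3] @ [2, a, 1] \<and> 1 \<le> k \<and> 3 \<le> a)"
  proof induction
    case (pair a b)
    then show ?case by (intro exI[of _ 1] exI[of _ a] exI[of _ b]) simp
  next
    case (triple a b)
    then show ?case using assms by (intro exI[of _ 0] exI[of _ a] exI[of _ b]) simp
  next
    case (special a)
    then show ?case by (intro exI[of _ 1] exI[of _ a] exI[of _ 1]) simp
  next
    case (rep ns)
    then obtain k a b where "1 \<le> a \<and> 1 \<le> b \<and>
        (ns = repeat k [1, lam] @ [a, b] \<and> 1 \<le> k \<and> lam \<le> a * b \<or>
         ns = repeat k [1, lam] @ [1, a, b] \<and> lam \<le> a \<or>
         lam = 3 \<and> ns = repeat k [1, 3] @ [2, a, 1] \<and> 1 \<le> k \<and> 3 \<le> a)"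
      by blast
    then show ?case by (intro exI[of _ "Suc k"] exI[of _ a] exI[of _ b]) (elim conjE disjE; simp)
  qed
  with ns(2) show "path_complete lam G"
    unfolding path_complete_def by metis
qed

text \<open>
  Moving one vertex from the last layer to the one before it pays for an exchange step that
  loses a single edge but increases the total distance by 1.
\<close>

fun pull_last :: "nat list \<Rightarrow> nat list" where
  "pull_last [p, q] = (if q = 1 then [Suc p] else [Suc p, q - 1])"
| "pull_last (x # r) = x # pull_last r"
| "pull_last [] = []"

text \<open>Positive pairs with sum at most \<open>lam\<close> <= 3 are (1,1), (1,2) and (2,1), and
  their products are too small.\<close>

lemma mult_ge_imp_add:
  fixes a b :: nat
  assumes "lam \<in> {2, 3}" "lam \<le> a * b"
  shows "Suc lam \<le> a + b" "1 \<le> a" "1 \<le> b"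
proof -
  show ab: "1 \<le> a" "1 \<le> b" using assms by (cases a; cases b; auto)+
  show "Suc lam \<le> a + b"
  proof (rule ccontr)
    assume "\<not> ?thesis"
    with assms(1) ab have "(a, b) \<in> {(1,1), (1,2), (2,1)}" by auto
    with assms \<open>\<not> ?thesis\<close> show False by auto
  qed
qed

text \<open>The converse holds for every \<open>lam\<close>, because (a - 1) * (b - 1) >= 0.\<close>

lemma mult_ge_if_add:
  fixes a b :: nat
  assumes "Suc lam \<le> a + b" "1 \<le> a" "1 \<le> b"
  shows "lam \<le> a * b"
proof -
  obtain a' b' where "a = Suc a'" "b = Suc b'" using assms by (metis One_nat_def Suc_le_D)
  then show ?thesis using assms by simp
qed

lemma pk_list_admissible:
  assumes "pk_list lam ns" "lam \<in> {2, 3}"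
  shows "admissible lam ns \<and> hd ns = 1 \<and> 3 \<le> length ns"
  using assms(1)
proof (induction rule: pk_list.induct)
  case (rep ns)
  then obtain t where "ns = 1 # t" by (cases ns) auto
  with rep show ?case by simp
next
  case (triple a b)
  then show ?case using mult_le_mono[of lam a 1 b] by simp
qed (use assms(2) in auto)

text \<open>The moved vertex stays adjacent to the last two layers and becomes adjacent to the layer
  before them, hence the three layers in the statement. That layer is nonempty, so at least one edge
  is gained.\<close>

lemma pull_last_gain:
  assumes "lam \<in> {2, 3}" "admissible lam (x # y # z # r)"
  shows "sum_list (pull_last (x # y # z # r)) = sum_list (x # y # z # r) \<and>
         Suc (dist_sum (pull_last (x # y # z # r))) = dist_sum (x # y # z # r) \<and>
         close_pairs (x # y # z # r) + 2 \<le> close_pairs (pull_last (x # y # z # r)) \<and>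
         admissible lam (pull_last (x # y # z # r))"
  using assms(2)
proof (induction r arbitrary: x y z)
  case Nil
  have yz: "Suc lam \<le> y + z" "1 \<le> y" "1 \<le> z" and xy: "lam \<le> x * y" "1 \<le> x"
    using mult_ge_imp_add[OF assms(1)] Nil by auto
  obtain z' where z: "z = Suc z'" using yz by (metis One_nat_def Suc_le_D)
  show ?case
  proof (cases "z = 1")
    case True with xy show ?thesis by (auto simp: algebra_simps)
  next
    case False
    with z have "lam \<le> Suc y * z'" using yz by (intro mult_ge_if_add) auto
    then show ?thesis using False xy z by (auto simp: algebra_simps)
  qed
next
  case (Cons w r)
  define p where "p = pull_last (z # w # r)"
  have eq: "pull_last (y # z # w # r) = y # p" "pull_last (x # y # z # w # r) = x # y # p"
    by (simp_all add: p_def)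
  have "sum_list (y # p) = sum_list (y # z # w # r) \<and>
         Suc (dist_sum (y # p)) = dist_sum (y # z # w # r) \<and>
         close_pairs (y # z # w # r) + 2 \<le> close_pairs (y # p) \<and> admissible lam (y # p)"
    using Cons.IH[of y z w] Cons.prems eq(1) by simp
  then show ?case
    unfolding eq(2) using Cons.prems by auto
qed

text \<open>A vertex moved from layer i to layer i + 1 adds 1 to the total distance and trades its
  neighbours in layer i - 1 for those in layer i + 2; the two layers themselves remain a clique.
  Each replacement keeps the order and lowers layer 1, or keeps layer 1 and lowers layer 2. The
  order drops only when a prefix \<open>[1, lam]\<close> is split off. This is the lexicographic
  measure of the induction.\<close>

lemma exists_dominating_pk_list:
  assumes lam: "lam \<in> {2, 3}" and "admissible lam s" "hd s = 1" "3 \<le> length s"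
  shows "\<exists>t. pk_list lam t \<and> dominated s t"
  using assms(2-4)
proof (induction s rule: wf_induct_rule[OF wf_measures[of "[sum_list, \<lambda>s. s ! 1, \<lambda>s. s ! 2]"]])
  case (1 s)
  have IH: "\<exists>t. pk_list lam t \<and> dominated s t"
    if "dominated s u" "admissible lam u" "hd u = 1" "3 \<le> length u"
       "u ! 1 < s ! 1 \<or> u ! 1 = s ! 1 \<and> u ! 2 < s ! 2" for u
  proof -
    have "(u, s) \<in> measures [sum_list, \<lambda>s. s ! 1, \<lambda>s. s ! 2]"
      using that(1,5) by (auto simp: dominated_def)
    then show ?thesis using 1(1)[of u] that dominated_trans by blast
  qed
  obtain a b r where s: "s = 1 # a # b # r"
    using 1(3,4) by (cases s; cases "tl s"; cases "tl (tl s)") auto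
  have a: "lam \<le> a" and adm: "admissible lam (a # b # r)" using 1(2) s by auto
  have b: "1 \<le> b" "1 \<le> a" using mult_ge_imp_add[OF lam, of a b] adm by auto
  show ?case
  proof (cases r)
    case Nil
    with s a b show ?thesis
      using pk_list.triple[of lam a b] by (auto intro!: exI[of _ s] simp: dominated_def)
  next
    case (Cons c r')
    have bc: "lam \<le> b * c" "admissible lam (c # r')" using adm Cons by auto
    have c: "1 \<le> c" using mult_ge_imp_add[OF lam bc(1)] by auto
    show ?thesis
    proof (cases "a = lam")
      case False
      then obtain k where k: "a = lam + k" "0 < k" using a by (metis le_eq_less_or_eq less_imp_add_positive)
      \<comment> \<open>the surplus of layer 1 moves to layer 2\<close>
      let ?u = "1 # lam # (b + k) # c # r'"
      have "k * 1 \<le> k * c" using c by (intro mult_le_mono) auto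
      then have "dominated s ?u"
        by (simp add: dominated_def s Cons k algebra_simps)
      moreover have "admissible lam ?u"
        using bc b by (auto intro: order_trans mult_le_mono)
      ultimately show ?thesis using k by (intro IH[of ?u]) (auto simp: s)
    next
      case a: True
      show ?thesis
      proof (cases r')
        case Nil
        then show ?thesis using s Cons a b c bc pk_list.pair[of b c lam]
          by (auto intro!: exI[of _ s] simp: dominated_def)
      next
        case r': (Cons d q)
        have cd: "lam \<le> c * d" "admissible lam (d # q)" using bc r' by auto
        have d: "1 \<le> d" using mult_ge_imp_add[OF lam cd(1)] by auto
        have s': "s = 1 # lam # b # c # d # q" using s Cons r' a by simp
        show ?thesis
        proof (cases "b = 1")
          case True
          have "admissible lam (b # c # d # q)" using 1(2) s' by simp
          then obtain t where t: "pk_list lam t" "dominated (b # c # d # q) t"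
            using 1(1)[of "b # c # d # q"] True s' by auto
          \<comment> \<open>Both tails begin with a layer of size 1, so the prefix
            \<open>[1, lam]\<close> contributes the same number of close pairs to each.\<close>
          have "hd t = 1" "t \<noteq> []" using pk_list_admissible[OF t(1) lam] by auto
          then obtain t' where t': "t = 1 # t'" by (cases t) auto
          have "dominated s (1 # lam # t)" using t(2) unfolding t' s' True
            by (simp add: dominated_def)
          then show ?thesis using t(1) pk_list.rep by blast
        next
          case False
          then obtain k where k: "b = Suc k" "1 \<le> k" using b by (cases b) auto
          consider "lam \<le> d" | "d = 1" "q = []" | e q' where "d = 1" "q = e # q'" | "lam = 3" "d = 2"
            using lam d by (cases q) force+
          then show ?thesis
          proof cases
            case 1
            \<comment> \<open>the surplus of layer 2 moves to layer 3\<close>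
            let ?u = "1 # lam # 1 # (c + k) # d # q"
            have "dominated s ?u"
              using mult_le_mono2[OF 1, of k] by (simp add: dominated_def s' k algebra_simps)
            moreover have "admissible lam ?u"
              using mult_ge_imp_add[OF lam bc(1)] k cd by (auto simp: algebra_simps)
            ultimately show ?thesis using k by (intro IH[of ?u]) (auto simp: s')
          next
            case 2
            show ?thesis
            \<comment> \<open>If one vertex of layer 2 and the single last vertex both join layer 3,
              the distances cancel and the size changes by \<open>b - lam\<close>. As
              \<open>b\<close> >= 2, this is negative only for \<open>lam\<close> = 3 and
              \<open>b\<close> = 2, the special family.\<close>
            proof (cases "lam = 3 \<and> b = 2")
              case True
              then show ?thesis using 2 s' cd pk_list.special[of lam c]
                by (auto intro!: exI[of _ s] simp: dominated_def)
            next
              case False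
              then have "lam \<le> Suc k" using lam k by auto
              then have "dominated s [1, lam, k, c + 2]"
                by (simp add: dominated_def s' k 2 algebra_simps)
              moreover have "lam \<le> k * (c + 2)"
                using k cd 2 by (metis le_add1 mult_le_mono nat_mult_1 order_trans mult.right_neutral)
              ultimately show ?thesis using k pk_list.pair[of k "c + 2" lam] by auto
            qed
          next
            case 3
            \<comment> \<open>the surplus of layer 2 moves to layer 4, where it sees layer 5 instead of layer 1\<close>
            let ?u = "1 # lam # 1 # c # Suc k # e # q'"
            have e: "lam \<le> e" using cd 3 by simp
            have "dominated s ?u"
              using mult_le_mono2[OF e, of k] by (simp add: dominated_def s' k 3 algebra_simps)
            moreover have "admissible lam ?u"
              using cd 3 k bc by (auto simp: algebra_simps intro: order_trans mult_le_mono)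
            ultimately show ?thesis using k by (intro IH[of ?u]) (auto simp: s')
          next
            case 4
            \<comment> \<open>moving a vertex from layer 2 to layer 3 loses one edge\<close>
            let ?v = "1 # lam # k # Suc c # d # q"
            have v: "admissible lam ?v"
            proof -
              have "lam \<le> k * Suc c"
                using mult_ge_imp_add[OF lam bc(1)] k by (intro mult_ge_if_add) auto
              then show ?thesis using cd k by (auto simp: algebra_simps)
            qed
            \<comment> \<open>\<open>pull_last\<close> acts beyond layer 2, so the decrease of layer
              2 is not undone.\<close>
            have eq: "pull_last ?v = 1 # lam # k # pull_last (Suc c # d # q)"
              by simp
            have "dominated s (pull_last ?v)"
              using pull_last_gain[OF lam v] by (simp add: dominated_def s' k 4 algebra_simps)
            moreover have "admissible lam (pull_last ?v)" using pull_last_gain[OF lam v] by blast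
            ultimately show ?thesis using k by (intro IH[of "pull_last ?v"]) (auto simp: s' eq)
          qed
        qed
      qed
    qed
  qed
qed

section \<open>Size and distance of path-complete graphs\<close>

text \<open>Strict in both components: the strict inequality between sizes excludes the wrong order
  in \<open>pk_list_dist_sum_antimono\<close>.\<close>

definition sparser :: "nat list \<Rightarrow> nat list \<Rightarrow> bool" where
  "sparser s t \<longleftrightarrow> dist_sum t < dist_sum s \<and> close_pairs s < close_pairs t"

lemma close_pairs_le: "close_pairs s \<le> sum_list s * sum_list s"
proof (induction s rule: close_pairs.induct)
  case (1 x y r)
  have "x * y \<le> x * sum_list (y # r)" by simp
  with 1 show ?case by (simp add: algebra_simps)
qed auto

text \<open>In \<open>[1, c, d]\<close> only the d pairs joining the two end layers are nonadjacent.
  In the longer list the first vertex already misses all M >= d vertices beyond layer 1, and layer 1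
  misses layer 3 as well.\<close>

lemma sparser_triple:
  assumes "1 \<le> lam" "lam \<le> c" "1 \<le> y" "sum_list (1 # lam # x # y # v) = sum_list [1, c, d]"
  shows "sparser (1 # lam # x # y # v) [1, c, d]"
proof -
  define M where "M = x + y + sum_list v"
  have M: "c + d = lam + M" "d \<le> M" "Suc x \<le> M" using assms by (auto simp: M_def)
  have "close_pairs (x # y # v) \<le> M * M" using close_pairs_le[of "x # y # v"] by (simp add: M_def add.assoc)
  moreover have "lam * Suc x \<le> lam * M" using M by (intro mult_le_mono) auto
  ultimately have "close_pairs (1 # lam # x # y # v) < 1 + 2 * lam + lam * lam + 2 * lam * M + M * M"
    using assms(1) by simp
  also have "\<dots> + 2 * d \<le> (1 + lam + M) * (1 + lam + M)"
    using M by (simp add: algebra_simps)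
  also have "\<dots> = close_pairs [1, c, d] + 2 * d"
  proof -
    have "1 + lam + M = 1 + c + d" using M by simp
    then show ?thesis by (simp only:) (simp add: algebra_simps)
  qed
  finally show ?thesis using M assms by (simp add: sparser_def M_def)
qed

text \<open>There are at least three nonempty layers: some pair is not close, and a vertex at
  distance 2 makes up for the root, which contributes 0.\<close>

lemma pk_list_bounds:
  assumes "pk_list lam ns" "1 \<le> lam"
  shows "close_pairs ns < sum_list ns * sum_list ns \<and> sum_list ns \<le> dist_sum ns \<and> (\<exists>t. ns = 1 # t)"
  using assms
proof induction
  case (rep ns)
  then obtain t where t: "ns = 1 # t" by auto
  have "lam * 1 \<le> lam * sum_list ns" using t by (intro mult_le_mono) auto
  with rep t show ?case by (simp add: algebra_simps)
qed (auto simp: algebra_simps)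

text \<open>Behind the common prefix, a and b form a clique, and the first of these layers is at
  least as large as that of \<open>ns\<close>, which is 1.\<close>

lemma sparser_pair:
  assumes "pk_list lam ns" "2 \<le> lam" "1 \<le> a" "sum_list ns = a + b"
  shows "sparser (1 # lam # ns) [1, lam, a, b]"
proof -
  obtain t where t: "ns = 1 # t" and *: "close_pairs ns < sum_list ns * sum_list ns" "sum_list ns \<le> dist_sum ns"
    using pk_list_bounds[of lam ns] assms(1,2) by force
  obtain a' where a: "a = Suc a'" using assms(3) by (cases a) auto
  have "close_pairs ns < a * a + 2 * a * b + b * b"
    using *(1) assms(4) by (simp add: algebra_simps)
  then have "close_pairs (1 # lam # ns) < close_pairs [1, lam, a, b]"
    unfolding t a by (simp add: algebra_simps)
  moreover have "dist_sum [1, lam, a, b] < dist_sum (1 # lam # ns)"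
    using *(2) assms(3,4) by simp
  ultimately show ?thesis by (simp only: sparser_def)
qed

text \<open>The tail 2, a, 1 misses two edges of a clique, but its second vertex next to layer 1
  gains three.\<close>

lemma sparser_special:
  assumes "pk_list 3 ns" "sum_list ns = a + 3"
  shows "sparser (1 # 3 # ns) [1, 3, 2, a, 1]"
proof -
  obtain t where t: "ns = 1 # t" and *: "close_pairs ns < sum_list ns * sum_list ns" "sum_list ns \<le> dist_sum ns"
    using pk_list_bounds[of 3 ns] assms(1) by force
  with assms show ?thesis unfolding sparser_def t
    by (simp add: algebra_simps)
qed

lemma pair_vs_special:
  assumes "1 \<le> a" "1 \<le> b" "a + b = c + 3"
  shows "dist_sum [1, 3, a, b] = dist_sum [1, 3, 2, c, 1] \<or> sparser [1, 3, 2, c, 1] [1, 3, a, b]"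
proof (cases "a = 1")
  case True
  with assms show ?thesis by simp
next
  case False
  then obtain a' where a: "a = a' + 2" using assms by (metis One_nat_def Suc_1 add.commute le_Suc_ex le_antisym not_less_eq_eq)
  have c: "c = a' + b - 1" "a' + b \<ge> 1" using assms a by auto
  then obtain b' where b: "b = Suc b'" using assms by (cases b) auto
  have "c = a' + b'" using c b by simp
  with a b show ?thesis by (simp add: sparser_def algebra_simps)
qed

lemma sparser_shift_two:
  assumes "x < x'" "x + y = x' + y'"
  shows "1 \<le> lam \<Longrightarrow> sparser [1, lam, x, y] [1, lam, x', y']" "sparser [1, x, y] [1, x', y']"
proof -
  obtain k where "x' = x + Suc k" using assms(1) less_imp_Suc_add by auto
  moreover from this have "y = y' + Suc k" using assms(2) by simp
  ultimately show "1 \<le> lam \<Longrightarrow> sparser [1, lam, x, y] [1, lam, x', y']" "sparser [1, x, y] [1, x', y']"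
    by (auto simp: sparser_def algebra_simps)
qed

text \<open>Apart from a common prefix, which cancels, lists are compared at the point where one of
  them ends. The first alternative is equality of distances and not of lists:
  \<open>[1, 3, 1, c + 2]\<close> and \<open>[1, 3, 2, c, 1]\<close> have the same total distance,
  but their sizes differ by one edge.\<close>

lemma pk_list_trichotomy:
  assumes lam: "lam \<in> {2, 3}" and "pk_list lam s" "pk_list lam t" "sum_list s = sum_list t"
  shows "dist_sum s = dist_sum t \<or> sparser s t \<or> sparser t s"
  using assms(2-4)
proof (induction arbitrary: t)
  case (pair a b)
  note s = pair
  from s(4) show ?case
  proof cases
    case (pair c d)
    from pair s have "a + b = c + d" by simp
    then show ?thesis unfolding pair
      using sparser_shift_two(1)[of a c b d lam] sparser_shift_two(1)[of c a d b lam] lam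
      by (cases a c rule: linorder_cases) auto
  next
    case (triple c d)
    then show ?thesis using sparser_triple[of lam c b a "[]" d] lam s by auto
  next
    case (special c)
    then show ?thesis using pair_vs_special[of a b c] s by auto
  next
    case (rep ns)
    then show ?thesis using sparser_pair[of lam ns a b] lam s by auto
  qed
next
  case (triple a b)
  note s = triple
  from s(3) show ?case
  proof cases
    case (pair c d)
    then show ?thesis using sparser_triple[of lam a d c "[]" b] lam s by auto
  next
    case (triple c d)
    then have "a + b = c + d" using s by simp
    then show ?thesis unfolding triple
      using sparser_shift_two(2) by (cases a c rule: linorder_cases) simp_all
  next
    case (special c)
    then show ?thesis using sparser_triple[of lam a c 2 "[1]" b] lam s by auto
  next
    case (rep ns)
    obtain x y v where "ns = x # y # v" "admissible lam ns"
      using pk_list_admissible[OF rep(2) lam] by (cases ns; cases "tl ns") auto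
    then have "1 \<le> y" using mult_ge_imp_add[OF lam, of x y] by auto
    then show ?thesis using sparser_triple[of lam a y x v b] lam s rep \<open>ns = _\<close> by auto
  qed
next
  case (special a)
  note s = special
  from s(3) show ?case
  proof cases
    case (pair c d)
    then show ?thesis using pair_vs_special[of c d a] s by auto
  next
    case (triple c d)
    then show ?thesis using sparser_triple[of lam c a 2 "[1]" d] lam s by auto
  next
    case (special c)
    then show ?thesis using s by simp
  next
    case (rep ns)
    then show ?thesis using sparser_special[of ns a] s by auto
  qed
next
  case (rep ns)
  note s = rep
  from s(3) show ?case
  proof cases
    case (pair c d)
    then show ?thesis using sparser_pair[of lam ns c d] lam s by auto
  next
    case (triple c d)
    obtain x y v where "ns = x # y # v" "admissible lam ns"
      using pk_list_admissible[OF s(1) lam] by (cases ns; cases "tl ns") auto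
    then have "1 \<le> y" using mult_ge_imp_add[OF lam, of x y] by auto
    then show ?thesis using sparser_triple[of lam c y x v d] lam s triple \<open>ns = _\<close> by auto
  next
    case (special c)
    then show ?thesis using sparser_special[of ns c] s by auto
  next
    case (rep ns')
    obtain u u' where "ns = 1 # u" "ns' = 1 # u'"
      using pk_list_bounds s(1) rep(2) lam by fastforce
    then show ?thesis using s(2)[of ns'] rep s(4) by (auto simp: sparser_def)
  qed
qed

corollary pk_list_dist_sum_antimono:
  assumes "lam \<in> {2, 3}" "pk_list lam s" "pk_list lam t" "sum_list s = sum_list t"
    and "close_pairs s \<le> close_pairs t"
  shows "dist_sum t \<le> dist_sum s"
  using pk_list_trichotomy[OF assms(1-4)] assms(5) by (auto simp: sparser_def)

section \<open>Layerings\<close>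

lemma sum_list_eq_sum_nth: "sum_list (ns :: nat list) = (\<Sum>i<length ns. ns ! i)"
  by (simp add: sum_list_sum_nth atLeast0LessThan)

text \<open>The recursion counts a vertex of layer i once for each of the i layers before
  it.\<close>

lemma dist_sum_eq: "dist_sum ns = (\<Sum>i<length ns. i * ns ! i)"
proof (induction ns)
  case (Cons x r)
  have "(\<Sum>i<length (x # r). i * (x # r) ! i) = (\<Sum>i<length r. Suc i * r ! i)"
    by (simp only: list.size add_0_right add_Suc_right sum.lessThan_Suc_shift nth_Cons_Suc)
  with Cons show ?case by (simp add: sum.distrib sum_list_eq_sum_nth)
qed simp

lemma close_pairs_eq:
  "close_pairs ns = (\<Sum>i<length ns. ns ! i * ns ! i) + 2 * (\<Sum>i<length ns - 1. ns ! i * ns ! Suc i)"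
proof (induction ns rule: close_pairs.induct)
  case (1 x y r)
  have "(\<Sum>i<length (x # y # r). (x # y # r) ! i * (x # y # r) ! i)
      = x * x + (\<Sum>i<length (y # r). (y # r) ! i * (y # r) ! i)"
    by (simp only: list.size add_0_right add_Suc_right sum.lessThan_Suc_shift nth_Cons_Suc) simp
  moreover have "(\<Sum>i<length (x # y # r) - 1. (x # y # r) ! i * (x # y # r) ! Suc i)
      = x * y + (\<Sum>i<length (y # r) - 1. (y # r) ! i * (y # r) ! Suc i)"
    by (simp del: sum.lessThan_Suc add: sum.lessThan_Suc_shift)
  ultimately show ?case using 1 by simp
qed auto

lemma admissible_iff: "admissible lam ns \<longleftrightarrow> (\<forall>i. Suc i < length ns \<longrightarrow> lam \<le> ns ! i * ns ! Suc i)"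
  by (induction lam ns rule: admissible.induct) (auto simp: nth_Cons split: nat.splits)

definition layering :: "'a set \<Rightarrow> ('a \<Rightarrow> nat) \<Rightarrow> nat list \<Rightarrow> bool" where
  "layering V l ns \<longleftrightarrow> finite V \<and> (\<forall>v\<in>V. l v < length ns) \<and>
     (\<forall>i<length ns. card {v \<in> V. l v = i} = ns ! i)"

lemma layering_sum:
  assumes "layering V l ns"
  shows "(\<Sum>v\<in>V. f (l v) :: nat) = (\<Sum>i<length ns. ns ! i * f i)"
proof -
  have "(\<Sum>v\<in>V. f (l v)) = (\<Sum>i<length ns. \<Sum>v\<in>{v \<in> V. l v = i}. f (l v))"
    using assms by (intro sum.group[symmetric]) (auto simp: layering_def)
  also have "\<dots> = (\<Sum>i<length ns. ns ! i * f i)"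
    using assms by (intro sum.cong) (auto simp: layering_def)
  finally show ?thesis .
qed

lemma layering_card: "layering V l ns \<Longrightarrow> card V = sum_list ns"
  using layering_sum[of V l ns "\<lambda>_. 1"] by (simp add: sum_list_eq_sum_nth)

lemma layering_dist_sum: "layering V l ns \<Longrightarrow> (\<Sum>v\<in>V. l v) = dist_sum ns"
  using layering_sum[of V l ns "\<lambda>i. i"] by (simp add: dist_sum_eq mult.commute)

text \<open>Applied with c = 0 and c = 1, which give the two sums of
  \<open>close_pairs_eq\<close>.\<close>

lemma card_layer_pairs:
  assumes "layering V l ns"
  shows "card {(x, y). x \<in> V \<and> y \<in> V \<and> l y = l x + c} = (\<Sum>i<length ns - c. ns ! i * ns ! (i + c))"
proof -
  let ?L = "\<lambda>i. {v \<in> V. l v = i}"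
  have "{(x, y). x \<in> V \<and> y \<in> V \<and> l y = l x + c} = (\<Union>i<length ns - c. ?L i \<times> ?L (i + c))"
    using assms by (force simp: layering_def)
  also have "card \<dots> = (\<Sum>i<length ns - c. card (?L i \<times> ?L (i + c)))"
    using assms by (intro card_UN_disjoint) (auto simp: layering_def)
  also have "\<dots> = (\<Sum>i<length ns - c. ns ! i * ns ! (i + c))"
    using assms by (intro sum.cong) (auto simp: layering_def card_cartesian_product)
  finally show ?thesis .
qed

section \<open>Distance layers of Eulerian digraphs\<close>

text \<open>\<open>di_dist\<close> minimises over paths, but appending an arc to a shortest path
  gives only a walk. Cutting out cycles does not lengthen it.\<close>

lemma (in wf_digraph) apath_of_awalk:
  assumes "awalk u p v"
  obtains q where "apath u q v" "length q \<le> length p"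
proof -
  have "\<exists>q. apath u q v \<and> length q \<le> length p"
    using assms
  proof (induct rule: awalk_to_apath_induct)
    case (path p)
    then show ?case by (auto simp: apath_def)
  next
    case (decomp p q r s)
    then have "p = q @ r @ s"
      using awalk_cyc_decomp_has_prop[of u p v] by simp
    with decomp show ?case by auto
  qed
  with that show thesis by blast
qed

lemma (in wf_digraph) di_dist_le: "awalk u p v \<Longrightarrow> di_dist G u v \<le> length p"
proof (erule apath_of_awalk)
  fix q assume "apath u q v" "length q \<le> length p"
  then show ?thesis unfolding di_dist_def by (blast intro: order_trans[OF Least_le])
qed

lemma (in wf_digraph) di_dist_attained:
  assumes "u \<rightarrow>\<^sup>* v"
  obtains p where "awalk u p v" "length p = di_dist G u v"
proof -
  have "\<exists>k p. apath u p v \<and> length p = k" using assms reachable_apath by blast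
  from LeastI_ex[OF this] show thesis
    unfolding di_dist_def[symmetric] using that awalkI_apath by blast
qed

lemma (in wf_digraph) di_dist_head_le:
  assumes "a \<in> arcs G" "u \<rightarrow>\<^sup>* tail G a"
  shows "di_dist G u (head G a) \<le> Suc (di_dist G u (tail G a))"
proof -
  obtain p where p: "awalk u p (tail G a)" "length p = di_dist G u (tail G a)"
    using di_dist_attained assms(2) by blast
  have "awalk u (p @ [a]) (head G a)"
    using p(1) arc_implies_awalk[OF assms(1)] by (rule awalk_appendI)
  from di_dist_le[OF this] p(2) show ?thesis by simp
qed

text \<open>Gives lower bounds on distances: a level function rising by at most 1 along each arc
  certifies them.\<close>

lemma (in wf_digraph) awalk_level_le:
  assumes "awalk u p v" "\<And>a. a \<in> arcs G \<Longrightarrow> l (head G a) \<le> Suc (l (tail G a) :: nat)"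
  shows "l v \<le> l u + length p"
  using assms(1)
proof (induction p arbitrary: u)
  case (Cons a p)
  then have "a \<in> arcs G" "u = tail G a" "l v \<le> l (head G a) + length p"
    by (auto simp: awalk_Cons_iff)
  with assms(2)[of a] show ?case by simp
qed (simp add: awalk_Nil_iff)

section \<open>Cuts, and the balance of forward and backward arcs\<close>

lemma wf_digraph_del_arcs: "wf_digraph D \<Longrightarrow> wf_digraph (del_arcs D A)"
  by (auto simp: wf_digraph_def del_arcs_def)

text \<open>Once the arcs leaving \<open>S\<close> are deleted, no walk from \<open>u\<close> leaves
  \<open>S\<close>.\<close>

lemma (in fin_digraph) cut_ge_edge_connectivity:
  assumes "edge_connected lam G" "S \<subseteq> verts G" "u \<in> S" "w \<in> verts G - S"
  shows "lam \<le> card {a \<in> arcs G. tail G a \<in> S \<and> head G a \<notin> S}"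
proof -
  let ?A = "{a \<in> arcs G. tail G a \<in> S \<and> head G a \<notin> S}"
  interpret H: wf_digraph "del_arcs G ?A" by (rule wf_digraph_del_arcs) unfold_locales
  have stay: "x \<in> S" if "u \<rightarrow>\<^sup>*\<^bsub>del_arcs G ?A\<^esub> x" for x
    using that
  proof (induction rule: H.reachable_induct)
    case (step x y)
    then show ?case by (auto simp: arcs_ends_conv del_arcs_def)
  qed (rule assms(3))
  have "\<not> strongly_connected (del_arcs G ?A)"
  proof
    assume "strongly_connected (del_arcs G ?A)"
    moreover have "u \<in> verts (del_arcs G ?A)" "w \<in> verts (del_arcs G ?A)"
      using assms(2-4) by (auto simp: del_arcs_def)
    ultimately have "w \<in> S" by (intro stay) (simp only: strongly_connected_def)
    with assms(4) show False by simp
  qed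
  then have "card ?A \<in> {card A | A. A \<subseteq> arcs G \<and> \<not> strongly_connected (del_arcs G A)}" (is "_ \<in> ?M")
    by (intro CollectI exI[of _ ?A]) auto
  moreover have "finite ?M"
    by (rule finite_subset[of _ "card ` Pow (arcs G)"]) auto
  ultimately have "Min ?M \<le> card ?A" by (intro Min_le)
  then show ?thesis
    using assms(1) by (simp add: edge_connected_def edge_connectivity_def)
qed

lemma (in fin_digraph) sum_arcs_head:
  "(\<Sum>a\<in>arcs G. f (head G a)) = (\<Sum>v\<in>verts G. in_degree G v * f v :: nat)"
proof -
  have "(\<Sum>a\<in>arcs G. f (head G a)) = (\<Sum>v\<in>verts G. \<Sum>a\<in>{a \<in> arcs G. head G a = v}. f (head G a))"
    by (rule sum.group[symmetric]) auto
  then show ?thesis by (simp add: in_degree_def in_arcs_def)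
qed

lemma (in fin_digraph) sum_arcs_tail:
  "(\<Sum>a\<in>arcs G. f (tail G a)) = (\<Sum>v\<in>verts G. out_degree G v * f v :: nat)"
proof -
  have "(\<Sum>a\<in>arcs G. f (tail G a)) = (\<Sum>v\<in>verts G. \<Sum>a\<in>{a \<in> arcs G. tail G a = v}. f (tail G a))"
    by (rule sum.group[symmetric]) auto
  then show ?thesis by (simp add: out_degree_def out_arcs_def)
qed

text \<open>In a balanced digraph the level differences along all arcs add up to 0.\<close>

lemma (in fin_digraph) card_backward_le_forward:
  fixes l :: "'a \<Rightarrow> nat"
  assumes "\<And>v. v \<in> verts G \<Longrightarrow> in_degree G v = out_degree G v"
    and "\<And>a. a \<in> arcs G \<Longrightarrow> l (head G a) \<le> Suc (l (tail G a))"
  shows "card {a \<in> arcs G. l (head G a) < l (tail G a)} \<le> card {a \<in> arcs G. l (head G a) = l (tail G a) + 1}"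
    (is "card ?B \<le> card ?F")
proof -
  \<comment> \<open>This holds arc by arc: a backward arc drops by at least 1 and a forward arc
    rises by exactly 1. Longer drops only help.\<close>
  have "(\<Sum>a\<in>arcs G. l (head G a) + of_bool (a \<in> ?B)) \<le> (\<Sum>a\<in>arcs G. l (tail G a) + of_bool (a \<in> ?F))"
    using assms(2) by (intro sum_mono) (force simp: of_bool_def le_Suc_eq)
  moreover have "arcs G \<inter> ?B = ?B" "arcs G \<inter> ?F = ?F" by auto
  ultimately have "(\<Sum>a\<in>arcs G. l (head G a)) + card ?B \<le> (\<Sum>a\<in>arcs G. l (tail G a)) + card ?F"
    by (simp add: sum.distrib Int_def)
  moreover have "(\<Sum>a\<in>arcs G. l (head G a)) = (\<Sum>a\<in>arcs G. l (tail G a))"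
    unfolding sum_arcs_head sum_arcs_tail using assms(1) by simp
  ultimately show ?thesis by simp
qed

lemma (in digraph) card_arcs_le:
  assumes "layering (verts G) l ns"
    and "\<And>v. v \<in> verts G \<Longrightarrow> in_degree G v = out_degree G v"
    and "\<And>a. a \<in> arcs G \<Longrightarrow> l (head G a) \<le> Suc (l (tail G a))"
  shows "card (arcs G) + card (verts G) \<le> close_pairs ns"
proof -
  let ?P = "\<lambda>c. {(x, y). x \<in> verts G \<and> y \<in> verts G \<and> l y = l x + c}"
  let ?B = "{a \<in> arcs G. l (head G a) < l (tail G a)}"
  let ?I = "{a \<in> arcs G. l (head G a) = l (tail G a)}"
  let ?F = "{a \<in> arcs G. l (head G a) = l (tail G a) + 1}"
  have fin: "finite (?P c)" for c
    by (rule finite_subset[of _ "verts G \<times> verts G"]) auto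
  have inj: "inj_on (arc_to_ends G) A" if "A \<subseteq> arcs G" for A
    using inj_on_arc_to_ends that by (rule inj_on_subset)
  have "card ?F \<le> card (?P 1)"
    by (intro card_inj_on_le[of "arc_to_ends G"] inj fin) (auto simp: arc_to_ends_def)
  \<comment> \<open>The vertices occupy the diagonal pairs, which no arc uses since there are no
    loops.\<close>
  moreover have "card (?I <+> verts G) \<le> card (?P 0)"
    by (intro card_inj_on_le[of "case_sum (arc_to_ends G) (\<lambda>v. (v, v))"] fin)
       (use inj[of ?I] no_loops in \<open>force simp: arc_to_ends_def inj_on_def split: sum.splits\<close>)+
  moreover have "card ?B \<le> card ?F"
    using assms by (intro card_backward_le_forward) auto
  moreover have "arcs G = ?B \<union> (?I \<union> ?F)" using assms(3) by (force simp: le_Suc_eq)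
  then have "card (arcs G) \<le> card ?B + (card ?I + card ?F)"
    by (metis (no_types, lifting) card_Un_le add_left_mono order_trans)
  ultimately show ?thesis
    using card_layer_pairs[OF assms(1), of 0] card_layer_pairs[OF assms(1), of 1]
    by (simp add: close_pairs_eq card_Plus)
qed

lemma eulerian_distance_layers:
  assumes "eulerian_digraph D" "edge_connected lam D" "2 \<le> card (verts D)" "v \<in> verts D"
  obtains ns where "admissible lam ns" "hd ns = 1" "2 \<le> length ns" "sum_list ns = card (verts D)"
    "dist_sum ns = (\<Sum>w\<in>verts D. di_dist D v w)"
    "card (arcs D) + card (verts D) \<le> close_pairs ns"
proof -
  interpret digraph D using assms(1) by (simp add: eulerian_digraph_def)
  have reach: "v \<rightarrow>\<^sup>*\<^bsub>D\<^esub> w" if "w \<in> verts D" for w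
    using assms(1,4) that by (auto simp: eulerian_digraph_def strongly_connected_def)
  have balanced: "in_degree D u = out_degree D u" if "u \<in> verts D" for u
  proof -
    obtain x p where "euler_trail x p x" using assms(1) unfolding eulerian_digraph_def by blast
    from closed_euler2(2)[OF this that] show ?thesis .
  qed
  define l where "l = di_dist D v"
  have step: "l (head D a) \<le> Suc (l (tail D a))" if "a \<in> arcs D" for a
    unfolding l_def using that reach by (intro di_dist_head_le) auto
  have l0: "l w = 0 \<longleftrightarrow> w = v" if "w \<in> verts D" for w
  proof
    assume "l w = 0"
    then obtain p where "awalk v p w" "length p = 0"
      using di_dist_attained[OF reach[OF \<open>w \<in> verts D\<close>]] by (auto simp: l_def)
    then show "w = v" by (simp add: awalk_Nil_iff)
  next
    assume "w = v"
    then show "l w = 0" using di_dist_le[of v "[]" v] assms(4) by (simp add: l_def awalk_Nil_iff)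
  qed
  define d where "d = Max (l ` verts D)"
  have le_d: "l w \<le> d" if "w \<in> verts D" for w
    using that by (simp add: d_def)
  have "d \<in> l ` verts D" unfolding d_def using assms(4) by (intro Max_in) auto
  then obtain z where z: "z \<in> verts D" "l z = d" by auto
  define ns where "ns = map (\<lambda>i. card {w \<in> verts D. l w = i}) [0..<Suc d]"
  have lay: "layering (verts D) l ns"
    unfolding layering_def ns_def using le_d by (auto simp del: upt_Suc simp: less_Suc_eq_le)
  have "\<not> verts D \<subseteq> {v}" using assms(3) card_mono[of "{v}" "verts D"] by auto
  then obtain w where "w \<in> verts D" "w \<noteq> v" by blast
  then have "d \<noteq> 0" using le_d[of w] l0[of w] by simp
  show thesis
  proof
    have "{w \<in> verts D. l w = 0} = {v}" using l0 assms(4) by auto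
    then show "hd ns = 1" by (simp add: ns_def upt_conv_Cons del: upt_Suc)
    show "2 \<le> length ns" using \<open>d \<noteq> 0\<close> by (simp add: ns_def)
    show "sum_list ns = card (verts D)" using layering_card[OF lay] by simp
    show "dist_sum ns = (\<Sum>w\<in>verts D. di_dist D v w)"
      using layering_dist_sum[OF lay] by (simp add: l_def)
    show "card (arcs D) + card (verts D) \<le> close_pairs ns"
      using card_arcs_le[OF lay balanced step] by simp
    show "admissible lam ns" unfolding admissible_iff
    proof safe
      fix i assume i: "Suc i < length ns"
      let ?L = "\<lambda>i. {w \<in> verts D. l w = i}"
      let ?S = "{w \<in> verts D. l w \<le> i}"
      let ?C = "{a \<in> arcs D. tail D a \<in> ?S \<and> head D a \<notin> ?S}"
      \<comment> \<open>An arc rises by at most one level, so it can leave \<open>?S\<close> only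
        from level i to level i + 1.\<close>
      have C: "arc_to_ends D ` ?C \<subseteq> ?L i \<times> ?L (Suc i)"
        using step by (fastforce simp: arc_to_ends_def)
      have "lam \<le> card ?C"
      proof (rule cut_ge_edge_connectivity[OF assms(2)])
        show "v \<in> ?S" using assms(4) l0[of v] by simp
        show "z \<in> verts D - ?S" using z i by (simp add: ns_def)
      qed simp
      also have "card ?C \<le> card (?L i \<times> ?L (Suc i))"
        using C by (intro card_inj_on_le[of "arc_to_ends D"] inj_on_subset[OF inj_on_arc_to_ends]) auto
      also have "\<dots> = ns ! i * ns ! Suc i"
        using i lay by (simp add: card_cartesian_product layering_def)
      finally show "lam \<le> ns ! i * ns ! Suc i" .
    qed
  qed
qed

section \<open>Bidirected sequential sums\<close>

text \<open>Describing a sequential sum by levels lets it share the counting lemmas with the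
  distance layers of a digraph.\<close>

definition layered_graph :: "'a ugraph \<Rightarrow> ('a \<Rightarrow> nat) \<Rightarrow> nat list \<Rightarrow> bool" where
  "layered_graph G l ns \<longleftrightarrow> layering (uverts G) l ns \<and>
     uedges G = {{x, y} | x y. x \<in> uverts G \<and> y \<in> uverts G \<and> x \<noteq> y \<and> l x \<le> Suc (l y) \<and> l y \<le> Suc (l x)}"

lemma layered_graph_edge_iff:
  assumes "layered_graph G l ns"
  shows "{x, y} \<in> uedges G \<longleftrightarrow>
    x \<in> uverts G \<and> y \<in> uverts G \<and> x \<noteq> y \<and> l x \<le> Suc (l y) \<and> l y \<le> Suc (l x)"
  using assms by (auto simp: layered_graph_def doubleton_eq_iff)

lemma is_K_sum_imp_layered_graph:
  assumes "is_K_sum ns G"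
  obtains l where "layered_graph G l ns"
proof -
  obtain Gs where Gs: "list_all2 is_complete ns Gs"
      "\<forall>j<length Gs. \<forall>i<j. uverts (Gs ! i) \<inter> uverts (Gs ! j) = {}" "G = sequential_sum Gs"
    using assms unfolding is_K_sum_def by blast
  have len: "length Gs = length ns" using Gs(1) by (simp add: list_all2_lengthD)
  have compl: "is_complete (ns ! i) (Gs ! i)" if "i < length ns" for i
    using Gs(1) that by (simp add: list_all2_nthD)
  have disj: "i = j" if "i < length ns" "j < length ns" "v \<in> uverts (Gs ! i)" "v \<in> uverts (Gs ! j)" for i j v
    using Gs(2) that len by (metis disjoint_iff linorder_neqE_nat)
  define l where "l v = (THE i. i < length ns \<and> v \<in> uverts (Gs ! i))" for v
  have l: "l v = i" if "i < length ns" "v \<in> uverts (Gs ! i)" for i v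
    unfolding l_def using that disj by (intro the_equality) auto
  have "set Gs = (!) Gs ` {..<length ns}" by (auto simp: set_conv_nth len)
  then have union: "uverts G = (\<Union>i<length ns. uverts (Gs ! i))"
    by (simp add: Gs(3) sequential_sum_def)
  have V: "v \<in> uverts G \<longleftrightarrow> l v < length ns \<and> v \<in> uverts (Gs ! l v)" for v
  proof
    assume "v \<in> uverts G"
    then obtain i where "i < length ns" "v \<in> uverts (Gs ! i)" using union by auto
    with l[of i v] show "l v < length ns \<and> v \<in> uverts (Gs ! l v)" by simp
  qed (auto simp: union)
  have layer: "{v \<in> uverts G. l v = i} = uverts (Gs ! i)" if "i < length ns" for i
    using l[OF that] that V by blast
  from union have "finite (uverts G)" using compl by (simp add: is_complete_def)
  then have "layering (uverts G) l ns"
    using layer compl V by (simp add: layering_def is_complete_def)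
  moreover have "uedges G = {{x, y} | x y. x \<in> uverts G \<and> y \<in> uverts G \<and> x \<noteq> y \<and> l x \<le> Suc (l y) \<and> l y \<le> Suc (l x)}"
    (is "_ = ?R")
  proof (intro equalityI subsetI)
    have R: "{x, y} \<in> ?R"
      if "x \<in> uverts G" "y \<in> uverts G" "x \<noteq> y" "l x \<le> Suc (l y)" "l y \<le> Suc (l x)" for x y
      using that by blast
    fix e assume "e \<in> uedges G"
    then consider i where "i < length ns" "e \<in> uedges (Gs ! i)"
      | x y i where "e = {x, y}" "Suc i < length ns" "x \<in> uverts (Gs ! i)" "y \<in> uverts (Gs ! Suc i)"
      by (auto simp: Gs(3) sequential_sum_def in_set_conv_nth len)
    then show "e \<in> ?R"
    proof cases
      case (1 i)
      then obtain x y where "e = {x, y}" "x \<in> uverts (Gs ! i)" "y \<in> uverts (Gs ! i)" "x \<noteq> y"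
        using compl[of i] by (auto simp: is_complete_def)
      moreover from this 1(1) have "l x = i" "l y = i" using l[of i x] l[of i y] by auto
      ultimately show ?thesis using 1(1) V[of x] V[of y] R[of x y] by simp
    next
      case (2 x y i)
      then have "l x = i" "l y = Suc i" using l[of i x] l[of "Suc i" y] by auto
      then have "x \<noteq> y" by auto
      with 2 \<open>l x = i\<close> \<open>l y = Suc i\<close> V[of x] V[of y] R[of x y] show ?thesis by auto
    qed
  next
    have dir: "{x, y} \<in> uedges G" if xy: "x \<in> uverts G" "y \<in> uverts G" "x \<noteq> y" "l y = l x \<or> l y = Suc (l x)" for x y
    proof (cases "l y = l x")
      case True
      then have "{x, y} \<in> uedges (Gs ! l x)"
        using xy V[of x] V[of y] compl[of "l x"] unfolding is_complete_def by auto
      moreover have "Gs ! l x \<in> set Gs" using xy(1) V[of x] len by simp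
      ultimately show ?thesis unfolding Gs(3) sequential_sum_def by auto
    next
      case False
      with xy have ly: "l y = Suc (l x)" by simp
      have "Suc (l x) < length Gs" "x \<in> uverts (Gs ! l x)" "y \<in> uverts (Gs ! Suc (l x))"
        using xy(1,2) V[of x] V[of y] ly len by simp_all
      then show ?thesis unfolding Gs(3) sequential_sum_def by auto
    qed
    fix e assume "e \<in> ?R"
    then obtain x y where "e = {x, y}" "x \<in> uverts G" "y \<in> uverts G" "x \<noteq> y" "l x \<le> Suc (l y)" "l y \<le> Suc (l x)"
      by blast
    then show "e \<in> uedges G"
      using dir[of x y] dir[of y x] by (auto simp: le_Suc_eq insert_commute)
  qed
  ultimately show thesis using that by (simp add: layered_graph_def)
qed

text \<open>Minimality of the extremal graph is tested over its own vertex type, so competitors are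
  built on a prescribed vertex set.\<close>

lemma is_K_sum_exists:
  assumes "finite V" "card V = sum_list ns"
  obtains G where "is_K_sum ns G" "uverts G = V"
proof -
  have "\<exists>Gs. list_all2 is_complete ns Gs \<and> (\<Union>G\<in>set Gs. uverts G) = V \<and>
    (\<forall>j<length Gs. \<forall>i<j. uverts (Gs ! i) \<inter> uverts (Gs ! j) = {})"
    using assms
  proof (induction ns arbitrary: V)
    case Nil
    then show ?case by simp
  next
    case (Cons n ns)
    then obtain U where U: "U \<subseteq> V" "card U = n" "finite U"
      using obtain_subset_with_card_n[of n V] by auto
    with Cons.prems have "card (V - U) = sum_list ns" by (simp add: card_Diff_subset)
    then obtain Gs where Gs: "list_all2 is_complete ns Gs" "(\<Union>G\<in>set Gs. uverts G) = V - U"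
      "\<forall>j<length Gs. \<forall>i<j. uverts (Gs ! i) \<inter> uverts (Gs ! j) = {}"
      using Cons.IH[of "V - U"] Cons.prems by auto
    let ?K = "\<lparr>uverts = U, uedges = {{x, y} | x y. x \<in> U \<and> y \<in> U \<and> x \<noteq> y}\<rparr>"
    have "uverts ?K \<inter> uverts (Gs ! j) = {}" if "j < length Gs" for j
      using Gs(2) that nth_mem by fastforce
    then have "\<forall>j<length (?K # Gs). \<forall>i<j. uverts ((?K # Gs) ! i) \<inter> uverts ((?K # Gs) ! j) = {}"
      using Gs(3) by (simp add: nth_Cons split: nat.splits)
    moreover have "list_all2 is_complete (n # ns) (?K # Gs)"
      using Gs(1) U by (simp add: is_complete_def)
    moreover have "(\<Union>G\<in>set (?K # Gs). uverts G) = V" using Gs(2) U by auto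
    ultimately show ?case by blast
  qed
  then obtain Gs where Gs: "list_all2 is_complete ns Gs" "(\<Union>G\<in>set Gs. uverts G) = V"
    "\<forall>j<length Gs. \<forall>i<j. uverts (Gs ! i) \<inter> uverts (Gs ! j) = {}" by blast
  then have "is_K_sum ns (sequential_sum Gs)" "uverts (sequential_sum Gs) = V"
    by (auto simp: is_K_sum_def sequential_sum_def)
  then show thesis by (rule that)
qed

text \<open>Arcs and diagonal together are exactly the pairs whose levels differ by at most 1, so
  the bound of \<open>card_arcs_le\<close> is attained.\<close>

lemma layered_graph_card_arcs:
  assumes "layered_graph G l ns"
  shows "card {(x, y). {x, y} \<in> uedges G} + card (uverts G) = close_pairs ns"
proof -
  let ?V = "uverts G"
  let ?A = "{(x, y). {x, y} \<in> uedges G}" and ?D = "(\<lambda>v. (v, v)) ` ?V"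
  let ?P = "\<lambda>c. {(x, y). x \<in> ?V \<and> y \<in> ?V \<and> l y = l x + c}"
  have lay: "layering ?V l ns" and fin: "finite ?V"
    using assms by (auto simp: layered_graph_def layering_def)
  have finP: "finite (?P c)" for c
    by (rule finite_subset[of _ "?V \<times> ?V"]) (use fin in auto)
  have "?A \<union> ?D = (?P 0 \<union> ?P 1) \<union> prod.swap ` ?P 1"
    by (auto simp: layered_graph_edge_iff[OF assms] image_iff le_Suc_eq)
  moreover have "card (?A \<union> ?D) = card ?A + card ?V"
  proof -
    have "finite ?A"
      by (rule finite_subset[of _ "?V \<times> ?V"]) (use fin in \<open>auto simp: layered_graph_edge_iff[OF assms]\<close>)
    then have "card (?A \<union> ?D) = card ?A + card ?D"
      using fin by (intro card_Un_disjoint) (auto simp: layered_graph_edge_iff[OF assms])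
    moreover have "card ?D = card ?V" by (intro card_image) (auto simp: inj_on_def)
    ultimately show ?thesis by simp
  qed
  moreover have "card ((?P 0 \<union> ?P 1) \<union> prod.swap ` ?P 1) = card (?P 0 \<union> ?P 1) + card (prod.swap ` ?P 1)"
    using finP[of 0] finP[of 1] by (intro card_Un_disjoint) auto
  moreover have "card (?P 0 \<union> ?P 1) = card (?P 0) + card (?P 1)"
    using finP[of 0] finP[of 1] by (intro card_Un_disjoint) auto
  moreover have "card (prod.swap ` ?P 1) = card (?P 1)"
    by (intro card_image) auto
  ultimately show ?thesis
    using card_layer_pairs[OF lay, of 0] card_layer_pairs[OF lay, of 1]
    by (simp add: close_pairs_eq)
qed

lemma card_arcs_eq_twice_edges:
  assumes "finite E" "\<And>e. e \<in> E \<Longrightarrow> \<exists>x y. x \<noteq> y \<and> e = {x, y}"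
  shows "card {(x, y). {x, y} \<in> E} = 2 * card E"
proof -
  have "{(x, y). {x, y} \<in> E} = (\<Union>e\<in>E. {(x, y). {x, y} = e})" by auto
  moreover have two: "finite {(x, y). {x, y} = e} \<and> card {(x, y). {x, y} = e} = 2" if e: "e \<in> E" for e
  proof -
    obtain u v where "u \<noteq> v" "e = {u, v}" using assms(2)[OF e] by blast
    then have "{(x, y). {x, y} = e} = {(u, v), (v, u)}" by (auto simp: doubleton_eq_iff)
    with \<open>u \<noteq> v\<close> show ?thesis by auto
  qed
  moreover have "card (\<Union>e\<in>E. {(x, y). {x, y} = e}) = (\<Sum>e\<in>E. card {(x, y). {x, y} = e})"
    using assms(1) two by (intro card_UN_disjoint) auto
  ultimately show ?thesis by simp
qed

lemma layered_graph_card_edges: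
  assumes "layered_graph G l ns"
  shows "2 * card (uedges G) + card (uverts G) = close_pairs ns"
proof -
  have "finite (uedges G)"
    by (rule finite_subset[of _ "Pow (uverts G)"]) (use assms in \<open>auto simp: layered_graph_def layering_def\<close>)
  then have "card {(x, y). {x, y} \<in> uedges G} = 2 * card (uedges G)"
    by (rule card_arcs_eq_twice_edges) (use assms in \<open>auto simp: layered_graph_def\<close>)
  with layered_graph_card_arcs[OF assms] show ?thesis by simp
qed

section \<open>Connectivity and remoteness of bidirected layered graphs\<close>

lemma bidirected_simps [simp]:
  "verts (bidirected G) = uverts G" "arcs (bidirected G) = {(x, y). {x, y} \<in> uedges G}"
  "tail (bidirected G) = fst" "head (bidirected G) = snd"
  by (simp_all add: bidirected_def)

lemma digraph_bidirected:
  assumes "layered_graph G l ns"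
  shows "digraph (bidirected G)"
proof
  have fin: "finite (uverts G)" using assms by (simp add: layered_graph_def layering_def)
  then show "finite (verts (bidirected G))" by simp
  show "finite (arcs (bidirected G))"
    by (rule finite_subset[of _ "uverts G \<times> uverts G"])
      (use fin in \<open>auto simp: layered_graph_edge_iff[OF assms]\<close>)
qed (auto simp: layered_graph_edge_iff[OF assms] arc_to_ends_def)

lemma bidirected_balanced: "in_degree (bidirected G) v = out_degree (bidirected G) v"
proof -
  have "in_arcs (bidirected G) v = prod.swap ` out_arcs (bidirected G) v"
    by (auto simp: in_arcs_def out_arcs_def image_iff insert_commute)
  then show ?thesis by (simp add: in_degree_def out_degree_def card_image)
qed

lemma strongly_connected_imp_connected:
  assumes "wf_digraph D" "strongly_connected D"
  shows "connected D"
proof -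
  interpret wf_digraph D by (rule assms(1))
  show ?thesis unfolding connected_def
    using assms(2) reachable_mk_symmetricI by (auto simp: strongly_connected_def)
qed

text \<open>
  Any two distinct vertices of a complete graph on more than \<open>lam\<close> vertices are joined by
  \<open>lam\<close> arc-disjoint walks of length at most 2.
\<close>

lemma clique_reachable_del_arcs:
  assumes "wf_digraph (del_arcs (bidirected G) A)" "finite A" "card A < lam"
    and K: "finite K" "Suc lam \<le> card K" "K \<subseteq> uverts G"
    and clique: "\<And>x y. x \<in> K \<Longrightarrow> y \<in> K \<Longrightarrow> x \<noteq> y \<Longrightarrow> {x, y} \<in> uedges G"
    and xy: "x \<in> K" "y \<in> K"
  shows "x \<rightarrow>\<^sup>*\<^bsub>del_arcs (bidirected G) A\<^esub> y"
proof (cases "x = y")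
  case True
  then show ?thesis using assms(1) K xy wf_digraph.reachable_refl[of "del_arcs (bidirected G) A"]
    by (auto simp: del_arcs_def)
next
  case False
  let ?H = "del_arcs (bidirected G) A"
  interpret H: wf_digraph ?H by (rule assms(1))
  have step: "u \<rightarrow>\<^bsub>?H\<^esub> w" if "u \<in> K" "w \<in> K" "u \<noteq> w" "(u, w) \<notin> A" for u w
    using clique[OF that(1-3)] that(4) by (force simp: arcs_ends_conv del_arcs_def)
  show ?thesis
  proof (rule ccontr)
    assume not: "\<not> x \<rightarrow>\<^sup>*\<^bsub>?H\<^esub> y"
    \<comment> \<open>\<open>f z\<close> is a deleted arc on the route from x to y through z, or the
      direct arc if z = y. The routes are arc-disjoint, so \<open>f\<close> is injective and at
      least \<open>lam\<close> arcs are deleted.\<close>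
    define f where "f z = (if z = y then (x, y) else if (x, z) \<in> A then (x, z) else (z, y))" for z
    have "(x, y) \<in> A" using step[OF xy False] not by blast
    moreover have "(x, z) \<in> A \<or> (z, y) \<in> A" if "z \<in> K - {x}" "z \<noteq> y" for z
      using step[of x z] step[of z y] not that xy H.reachable_adj_trans by blast
    ultimately have "f ` (K - {x}) \<subseteq> A" by (auto simp: f_def)
    moreover have "inj_on f (K - {x})" by (auto simp: inj_on_def f_def split: if_splits)
    ultimately have "card (K - {x}) \<le> card A" using assms(2) by (intro card_inj_on_le)
    then show False using K xy assms(3) by simp
  qed
qed

context
  fixes G :: "'a ugraph" and l ns and lam :: nat
  assumes G: "layered_graph G l ns" and lam: "lam \<in> {2, 3}"
    and adm: "admissible lam ns" and len: "2 \<le> length ns"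
begin

lemma layering_uverts: "layering (uverts G) l ns"
  using G by (simp add: layered_graph_def)

lemma finite_uverts: "finite (uverts G)"
  using layering_uverts by (simp add: layering_def)

lemma layer_product: "Suc i < length ns \<Longrightarrow> lam \<le> ns ! i * ns ! Suc i"
  using adm by (simp add: admissible_iff)

lemma layer_nonempty:
  assumes "i < length ns"
  shows "\<exists>z. z \<in> uverts G \<and> l z = i"
proof -
  have "1 \<le> ns ! i"
  proof (cases "Suc i < length ns")
    case True
    then show ?thesis using mult_ge_imp_add(2)[OF lam layer_product] by blast
  next
    case False
    then obtain j where j: "i = Suc j" using len assms by (cases i) auto
    then show ?thesis using mult_ge_imp_add(3)[OF lam layer_product[of j]] assms by simp
  qed
  then have "card {v \<in> uverts G. l v = i} \<noteq> 0" using layering_uverts assms by (simp add: layering_def)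
  then have "{v \<in> uverts G. l v = i} \<noteq> {}" by (metis card.empty)
  then show ?thesis by blast
qed

text \<open>Two consecutive layers form a clique on at least \<open>lam\<close> + 1 vertices, whose
  vertices still reach each other after the deletion. Successive cliques share a nonempty layer,
  which links them.\<close>

lemma strongly_connected_del_arcs:
  assumes "finite A" "card A < lam"
  shows "strongly_connected (del_arcs (bidirected G) A)"
proof -
  let ?H = "del_arcs (bidirected G) A"
  have wf: "wf_digraph ?H"
    using digraph_bidirected[OF G] by (intro wf_digraph_del_arcs) (simp add: digraph_def fin_digraph_def)
  interpret H: wf_digraph ?H by (rule wf)
  have adjacent_layers: "x \<rightarrow>\<^sup>*\<^bsub>?H\<^esub> y"
    if i: "Suc i < length ns" and x: "x \<in> uverts G" "l x = i \<or> l x = Suc i"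
      and y: "y \<in> uverts G" "l y = i \<or> l y = Suc i" for i x y
  proof -
    let ?L = "\<lambda>i. {v \<in> uverts G. l v = i}"
    have "card (?L i \<union> ?L (Suc i)) = ns ! i + ns ! Suc i"
      using layering_uverts i by (subst card_Un_disjoint) (auto simp: layering_def)
    then have "Suc lam \<le> card (?L i \<union> ?L (Suc i))"
      using mult_ge_imp_add(1)[OF lam layer_product[OF i]] by simp
    then show ?thesis
      using x y finite_uverts
      by (intro clique_reachable_del_arcs[OF wf assms, of "?L i \<union> ?L (Suc i)"])
         (auto simp: layered_graph_edge_iff[OF G])
  qed
  have reach: "x \<rightarrow>\<^sup>*\<^bsub>?H\<^esub> y"
    if "i < length ns" "x \<in> uverts G" "y \<in> uverts G" "l x \<le> i" "l y \<le> i" for i x y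
    using that
  proof (induction i arbitrary: x y)
    case 0
    then show ?case using adjacent_layers[of 0 x y] len by auto
  next
    case (Suc i)
    obtain z where z: "z \<in> uverts G" "l z = i" using layer_nonempty[of i] Suc.prems(1) by auto
    have "w \<rightarrow>\<^sup>*\<^bsub>?H\<^esub> z \<and> z \<rightarrow>\<^sup>*\<^bsub>?H\<^esub> w" if w: "w \<in> uverts G" "l w \<le> Suc i" for w
    proof (cases "l w \<le> i")
      case True
      then show ?thesis using Suc.IH[of w z] Suc.IH[of z w] Suc.prems(1) w z by simp
    next
      case False
      then show ?thesis using adjacent_layers[of i w z] adjacent_layers[of i z w] Suc.prems(1) w z by simp
    qed
    then show ?case using H.reachable_trans Suc.prems by blast
  qed
  have "l x \<le> length ns - 1" if "x \<in> uverts G" for x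
    using that layering_uverts by (auto simp: layering_def)
  then have "x \<rightarrow>\<^sup>*\<^bsub>?H\<^esub> y" if "x \<in> uverts G" "y \<in> uverts G" for x y
    using reach[of "length ns - 1" x y] that len by simp
  moreover have "uverts G \<noteq> {}" using layer_nonempty[of 0] len by force
  ultimately show ?thesis by (simp add: strongly_connected_def del_arcs_def)
qed

lemma strongly_connected_bidirected: "strongly_connected (bidirected G)"
proof -
  have "del_arcs (bidirected G) {} = bidirected G" by (simp add: del_arcs_def del: bidirected_simps)
  with strongly_connected_del_arcs[of "{}"] lam show ?thesis by auto
qed

lemma eulerian_bidirected: "eulerian_digraph (bidirected G)"
proof -
  interpret digraph "bidirected G" by (rule digraph_bidirected[OF G])
  have "connected (bidirected G)"
    using strongly_connected_bidirected by (intro strongly_connected_imp_connected) unfold_locales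
  then have "\<exists>u p. euler_trail u p u"
    using bidirected_balanced by (intro closed_euler1)
  then show ?thesis
    using strongly_connected_bidirected digraph_bidirected[OF G] by (simp add: eulerian_digraph_def)
qed

lemma edge_connected_bidirected: "edge_connected lam (bidirected G)"
proof -
  let ?D = "bidirected G"
  let ?M = "{card A | A. A \<subseteq> arcs ?D \<and> \<not> strongly_connected (del_arcs ?D A)}"
  interpret digraph ?D by (rule digraph_bidirected[OF G])
  have "finite ?M" by (rule finite_subset[of _ "card ` Pow (arcs ?D)"]) (use finite_arcs in auto)
  \<comment> \<open>\<open>Min\<close> says nothing about an empty set; deleting all arcs provides a
    member.\<close>
  moreover have "?M \<noteq> {}"
  proof -
    obtain x y where xy: "x \<in> uverts G" "l x = 0" "y \<in> uverts G" "l y = 1"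
      using layer_nonempty[of 0] layer_nonempty[of 1] len by force
    interpret H: wf_digraph "del_arcs ?D (arcs ?D)" by (rule wf_digraph_del_arcs) unfold_locales
    have ends: "arcs_ends (del_arcs ?D (arcs ?D)) = {}" by (simp add: arcs_ends_conv del_arcs_def)
    have "\<not> x \<rightarrow>\<^sup>*\<^bsub>del_arcs ?D (arcs ?D)\<^esub> y"
      unfolding H.reachable_conv ends using xy by auto
    then have "\<not> strongly_connected (del_arcs ?D (arcs ?D))"
      using xy by (auto simp: strongly_connected_def del_arcs_def)
    then show ?thesis by blast
  qed
  moreover have "lam \<le> m" if "m \<in> ?M" for m
    using that strongly_connected_del_arcs finite_subset[OF _ finite_arcs] not_less by blast
  ultimately show ?thesis
    by (simp add: edge_connected_def edge_connectivity_def)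
qed

lemma remoteness_bidirected_ge: "real (dist_sum ns) / (real (card (uverts G)) - 1) \<le> remoteness (bidirected G)"
proof -
  let ?D = "bidirected G"
  interpret digraph ?D by (rule digraph_bidirected[OF G])
  obtain u where u: "u \<in> uverts G" "l u = 0" using layer_nonempty[of 0] len by force
  have "l w \<le> di_dist ?D u w" if w: "w \<in> uverts G" for w
  proof -
    have "u \<rightarrow>\<^sup>*\<^bsub>?D\<^esub> w"
      using strongly_connected_bidirected u w by (simp add: strongly_connected_def)
    then obtain p where "awalk u p w" "length p = di_dist ?D u w" using di_dist_attained by blast
    with awalk_level_le[of u p w l] u show ?thesis
      by (auto simp: layered_graph_edge_iff[OF G])
  qed
  then have "dist_sum ns \<le> (\<Sum>w\<in>uverts G. di_dist ?D u w)"
    using layering_dist_sum[OF layering_uverts] by (metis sum_mono)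
  then have "real (dist_sum ns) \<le> (\<Sum>w\<in>uverts G. real (di_dist ?D u w))"
    by (metis of_nat_le_iff of_nat_sum)
  moreover have "0 < card (uverts G)" using u finite_uverts by (auto simp: card_gt_0_iff)
  ultimately have "real (dist_sum ns) / (real (card (uverts G)) - 1)
      \<le> (\<Sum>w\<in>uverts G. real (di_dist ?D u w)) / (real (card (uverts G)) - 1)"
    by (intro divide_right_mono) auto
  also have "\<dots> \<le> remoteness ?D"
    unfolding remoteness_def using u finite_uverts by (intro Max_ge) auto
  finally show ?thesis .
qed

end

section \<open>Remoteness of Eulerian digraphs\<close>

theorem theorem4p7:
  fixes lam n m0 :: nat and PK :: "'v ugraph"
  assumes "lam \<in> {2, 3}" and "1 \<le> n" and "1 \<le> m0"
    and "min_path_complete lam n m0 PK"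
  shows "(\<forall>D :: ('a, 'b) pre_digraph.
            eulerian_digraph D \<and> edge_connected lam D \<and>
            card (verts D) = n \<and> 2 * m0 \<le> card (arcs D)
            \<longrightarrow> remoteness D \<le> remoteness (bidirected PK)) \<and>
         (\<exists>D :: ('v, 'v \<times> 'v) pre_digraph.
            eulerian_digraph D \<and> edge_connected lam D \<and>
            card (verts D) = n \<and> 2 * m0 \<le> card (arcs D) \<and>
            remoteness D = remoteness (bidirected PK))"
proof -
  note lam = assms(1)
  have pc_iff: "path_complete lam H \<longleftrightarrow> (\<exists>ns. pk_list lam ns \<and> is_K_sum ns H)" for H :: "'v ugraph"
    using lam by (intro path_complete_iff) auto
  have cardPK: "card (uverts PK) = n" "m0 \<le> card (uedges PK)"
    using assms(4) by (auto simp: min_path_complete_def)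
  have minPK: "card (uedges PK) \<le> card (uedges H)"
    if "path_complete lam H" "card (uverts H) = n" "m0 \<le> card (uedges H)" for H :: "'v ugraph"
    using assms(4) that by (auto simp: min_path_complete_def)
  obtain g where g: "pk_list lam g" "is_K_sum g PK"
    using assms(4) pc_iff by (auto simp: min_path_complete_def)
  obtain l where l: "layered_graph PK l g" using is_K_sum_imp_layered_graph[OF g(2)] .
  obtain g' where g': "g = 1 # g'" using pk_list_bounds[OF g(1)] lam by auto
  have adm: "admissible lam g" and len: "3 \<le> length g"
    using pk_list_admissible[OF g(1) lam] by auto
  then have "2 \<le> length g" by simp
  note PK = l lam adm this
  have fin: "finite (uverts PK)" using l by (simp add: layered_graph_def layering_def)
  have sum_g: "sum_list g = n" using layering_card[of "uverts PK" l g] l cardPK(1) by (simp add: layered_graph_def)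
  have le_g: "dist_sum ns \<le> dist_sum g"
    if ns: "admissible lam ns" "hd ns = 1" "2 \<le> length ns" "sum_list ns = n" "2 * m0 + n \<le> close_pairs ns" for ns
  proof (cases "length ns = 2")
    case True
    \<comment> \<open>With two layers all distances from the root are 1, and the total n - 1 is the
      least possible.\<close>
    then obtain m where "ns = [1, m]" using ns(2) by (cases ns; cases "tl ns") auto
    then show ?thesis using ns(4) sum_g g' by simp
  next
    case False
    then obtain t where t: "pk_list lam t" "dominated ns t"
      using exists_dominating_pk_list[OF lam ns(1,2)] ns(3) by auto
    \<comment> \<open>Realising the dominating list on the vertices of \<open>PK\<close> makes it a
      competitor in the minimality of \<open>PK\<close>.\<close>
    obtain H where H: "is_K_sum t H" "uverts H = uverts PK"
      using is_K_sum_exists[OF fin, of t] t(2) ns(4) cardPK(1) by (auto simp: dominated_def)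
    obtain k where "layered_graph H k t" using is_K_sum_imp_layered_graph[OF H(1)] .
    from layered_graph_card_edges[OF this] have *: "2 * card (uedges H) + n = close_pairs t"
      by (simp add: H(2) cardPK(1))
    with t(2) ns(5) have "m0 \<le> card (uedges H)" by (simp add: dominated_def)
    then have "card (uedges PK) \<le> card (uedges H)"
      using t(1) H cardPK(1) by (intro minPK) (auto simp: pc_iff)
    with * layered_graph_card_edges[OF l] cardPK(1) have "close_pairs g \<le> close_pairs t" by simp
    then have "dist_sum t \<le> dist_sum g"
      using t ns(4) sum_g by (intro pk_list_dist_sum_antimono[OF lam g(1) t(1)]) (auto simp: dominated_def)
    then show ?thesis using t(2) by (simp add: dominated_def)
  qed
  have "remoteness D \<le> remoteness (bidirected PK)"
    if D: "eulerian_digraph D" "edge_connected lam D" "card (verts D) = n" "2 * m0 \<le> card (arcs D)"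
    for D :: "('a, 'b) pre_digraph"
  proof -
    have n: "2 \<le> n" using g(1) sum_g lam by cases auto
    have "(\<Sum>w\<in>verts D. real (di_dist D v w)) / (real n - 1) \<le> remoteness (bidirected PK)"
      if v: "v \<in> verts D" for v
    proof -
      obtain ns where ns: "admissible lam ns" "hd ns = 1" "2 \<le> length ns" "sum_list ns = n"
        "dist_sum ns = (\<Sum>w\<in>verts D. di_dist D v w)" "card (arcs D) + n \<le> close_pairs ns"
        using eulerian_distance_layers[OF D(1,2) _ v] D(3) n by auto
      have "dist_sum ns \<le> dist_sum g" using le_g[OF ns(1-4)] ns(6) D(4) by simp
      then have "(\<Sum>w\<in>verts D. real (di_dist D v w)) / (real n - 1) \<le> real (dist_sum g) / (real n - 1)"
        using n ns(5) by (intro divide_right_mono) (simp_all flip: of_nat_sum)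
      with remoteness_bidirected_ge[OF PK] cardPK(1) show ?thesis by simp
    qed
    moreover have "finite (verts D)" "verts D \<noteq> {}" using D(3) n by (auto intro: card_ge_0_finite)
    ultimately show ?thesis by (simp add: remoteness_def D(3))
  qed
  moreover have "2 * m0 \<le> card (arcs (bidirected PK))"
    using layered_graph_card_arcs[OF l] layered_graph_card_edges[OF l] cardPK(2) by simp
  ultimately show ?thesis
    using eulerian_bidirected[OF PK] edge_connected_bidirected[OF PK] cardPK(1)
    by (intro conjI allI impI exI[of _ "bidirected PK"]) (auto simp del: bidirected_simps(2))
qed

end
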